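(* Let $n\ge 1$ and $M>n$. There exists a sequence of centered probability measures $d\mu_k=f_k\,d\gamma$ in $\mathcal{P}_2^M(\mathbb{R}^n)$ such that $\lim_{k\to\infty}\delta_{\mathrm{Tal}}(\mu_k)=0$ and $$\lim_{k\to\infty}W_2(\mu_k,\gamma)=c$$ for some constant $c>0$.
   Context: $d\gamma=(2\pi)^{-n/2}e^{-|x|^2/2}\,dx$ is the standard Gaussian measure on $\mathbb{R}^n$. For a probability measure $d\mu=f\,d\gamma$ with $f\ge 0$ in $L^1(d\gamma)$, the relative entropy is $\mathrm{H}(\mu)=\int_{\mathbb{R}^n}f\log f\,d\gamma$. The quadratic Wasserstein distance is $W_2(\mu,\nu)=\inf_\pi\left(\iint|x-y|^2\,d\pi(x,y)\right)^{1/2}$, the infimum being over all probability measures $\pi$ on $\mathbb{R}^n\times\mathbb{R}^n$ with marginals $\mu$ and $\nu$. The deficit of Talagrand's transportation inequality is $\delta_{\mathrm{Tal}}(\mu)=2\mathrm{H}(\mu)-W_2^2(\mu,\gamma)\ge 0$. Centered means the barycenter $\int x\,d\mu$ is $0$. $\mathcal{P}_2^M(\mathbb{R}^n)$ is the set of probability measures $\mu$ on $\mathbb{R}^n$ with second moment $m_2(\mu)=\int|x|^2\,d\mu\le M$. *)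

theory Defs
  imports "HOL-Probability.Probability"
begin

definition std_gaussian :: "(real ^ 'n) measure" where
  "std_gaussian =
     density lborel
       (\<lambda>x. ennreal ((2 * pi) powr (- (real CARD('n) / 2)) * exp (- (norm x)\<^sup>2 / 2)))"

text \<open>The integral of f log f against the Gaussian measure may be infinite, so it is the difference
  of the integrals of the positive and negative parts. The latter is finite, because
  t log t is at least -1/e. The density f is the Radon-Nikodym derivative, which is determined up
  to null sets; a measure without density gets entropy infinity, as is customary. Note that
  \<^term>\<open>0 * ln 0 = (0::real)\<close>.\<close>

definition rel_entropy :: "(real ^ 'n) measure \<Rightarrow> ereal" where
  "rel_entropy \<mu> =
     (if absolutely_continuous std_gaussian \<mu>
      then (let f = (\<lambda>x. enn2real (RN_deriv std_gaussian \<mu> x))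
            in enn2ereal (\<integral>\<^sup>+ x. ennreal (f x * ln (f x)) \<partial>std_gaussian)
               - enn2ereal (\<integral>\<^sup>+ x. ennreal (- (f x * ln (f x))) \<partial>std_gaussian))
      else \<infinity>)"

definition couplings ::
  "(real ^ 'n) measure \<Rightarrow> (real ^ 'n) measure \<Rightarrow> ((real ^ 'n) \<times> (real ^ 'n)) measure set" where
  "couplings \<mu> \<nu> =
     {\<pi>. sets \<pi> = sets (borel \<Otimes>\<^sub>M borel) \<and> prob_space \<pi> \<and>
         distr \<pi> borel fst = \<mu> \<and> distr \<pi> borel snd = \<nu>}"

definition sqrt_ennreal :: "ennreal \<Rightarrow> ennreal" where
  "sqrt_ennreal t = (if t = \<infinity> then \<infinity> else ennreal (sqrt (enn2real t)))"

definition W2 :: "(real ^ 'n) measure \<Rightarrow> (real ^ 'n) measure \<Rightarrow> ennreal" where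
  "W2 \<mu> \<nu> =
     (INF \<pi>\<in>couplings \<mu> \<nu>.
        sqrt_ennreal (\<integral>\<^sup>+ z. ennreal ((norm (fst z - snd z))\<^sup>2) \<partial>\<pi>))"

text \<open>For measures with finite second moment \<^const>\<open>W2\<close> is finite, so the following subtraction
  is the usual one; the value is infinite exactly when the entropy is.\<close>

definition talagrand_deficit :: "(real ^ 'n) measure \<Rightarrow> ereal" where
  "talagrand_deficit \<mu> = 2 * rel_entropy \<mu> - enn2ereal ((W2 \<mu> std_gaussian)\<^sup>2)"

definition second_moment :: "(real ^ 'n) measure \<Rightarrow> ennreal" where
  "second_moment \<mu> = (\<integral>\<^sup>+ x. ennreal ((norm x)\<^sup>2) \<partial>\<mu>)"

definition P2 :: "real \<Rightarrow> (real ^ 'n) measure set" where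
  "P2 M = {\<mu>. sets \<mu> = sets borel \<and> prob_space \<mu> \<and> second_moment \<mu> \<le> ennreal M}"

text \<open>Integrability is required because the Bochner integral of a non-integrable function
  is 0 by convention.\<close>

definition centered :: "(real ^ 'n) measure \<Rightarrow> bool" where
  "centered \<mu> \<longleftrightarrow> integrable \<mu> (\<lambda>x. x) \<and> (\<integral>x. x \<partial>\<mu>) = 0"

end

theory Submission
  imports Defs "HOL-Real_Asymp.Real_Asymp"
begin

text \<open>Send a vanishing mass \<open>p\<close> to infinity at finite cost: \<open>\<mu>\<close> is the mixture of \<open>\<gamma>\<close> with weight
  \<open>1 - p\<close> and of the two translates of \<open>\<gamma>\<close> by \<open>a\<close> and \<open>-a\<close> with weight \<open>p / 2\<close> each, where
  \<open>p \<bar>a\<bar>\<^sup>2 = s = M - n\<close> is kept fixed and \<open>p\<close> tends to 0. By convexity of \<open>t ln t\<close> the entropy is at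
  most \<open>s / 2\<close>; the components being almost singular to each other, it is also at least
  \<open>s / 2 - o(1)\<close>. Leaving the mass at the origin in place and translating the rest gives
  \<open>W\<^sub>2\<^sup>2 \<le> s\<close>. Conversely, whatever the coupling, the distant mass must be matched with a part of \<open>\<gamma>\<close> of
  small mass, whose second moment is \<open>o(1)\<close> because \<open>\<gamma>\<close> has finite fourth moments; hence
  \<open>W\<^sub>2\<^sup>2 \<ge> s - o(1)\<close>. So the deficit tends to 0 while \<open>W\<^sub>2\<close> tends to \<open>sqrt s\<close>.\<close>

section \<open>Moments and translates of the standard Gaussian\<close>

lemma norm_power2_eq_sum_Basis:
  fixes x :: "'a :: euclidean_space"
  shows "(norm x)\<^sup>2 = (\<Sum>b\<in>Basis. (x \<bullet> b)\<^sup>2)"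
  unfolding power2_norm_eq_inner by (subst euclidean_inner) (simp add: power2_eq_square)

text \<open>The exponential of a sum over \<open>Basis\<close> splits into a product, so Fubini for
  \<open>lborel\<close> reduces Gaussian integrals to one-dimensional ones.\<close>

lemma std_gaussian_density_prod:
  fixes x :: "real ^ 'n"
  shows "(2 * pi) powr (- (real CARD('n) / 2)) * exp (- (norm x)\<^sup>2 / 2) =
    (\<Prod>b\<in>Basis. std_normal_density (x \<bullet> b))"
proof -
  have "(\<Prod>b\<in>(Basis :: (real^'n) set). std_normal_density (x \<bullet> b)) =
     (1 / sqrt (2 * pi)) ^ CARD('n) * exp (\<Sum>b\<in>Basis. - (x \<bullet> b)\<^sup>2 / 2)"
    by (simp add: std_normal_density_def prod_dividef exp_sum power_divide)
  also have "(\<Sum>b\<in>Basis. - (x \<bullet> b)\<^sup>2 / 2) = - (norm x)\<^sup>2 / 2"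
    by (simp add: norm_power2_eq_sum_Basis sum_negf sum_divide_distrib)
  also have "(1 / sqrt (2 * pi)) ^ CARD('n) = (2 * pi) powr (- (real CARD('n) / 2))"
    by (simp add: powr_minus powr_half_sqrt_powr powr_realpow field_simps real_sqrt_mult real_sqrt_power power_mult_distrib)
  finally show ?thesis ..
qed

lemma
  shows sets_std_gaussian [simp, measurable_cong]: "sets std_gaussian = sets borel"
    and space_std_gaussian [simp]: "space std_gaussian = UNIV"
  by (simp_all add: std_gaussian_def)

text \<open>By Fubini, every coordinate other than \<open>b\<close> contributes a factor 1.\<close>

lemma nn_integral_std_gaussian_inner:
  fixes b :: "real ^ 'n"
  assumes b: "b \<in> Basis" and [measurable]: "h \<in> borel_measurable borel"
  shows "(\<integral>\<^sup>+x. h (x \<bullet> b) \<partial>std_gaussian) = (\<integral>\<^sup>+t. ennreal (std_normal_density t) * h t \<partial>lborel)"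
proof -
  let ?f = "\<lambda>c t. ennreal (std_normal_density t) * (if c = b then h t else 1)"
  have one: "(\<integral>\<^sup>+t. ennreal (std_normal_density t) \<partial>lborel) = 1"
    using prob_space.emeasure_space_1[OF prob_space_normal_density[of 1 0]]
    by (simp add: emeasure_density)
  have "(\<integral>\<^sup>+x. h (x \<bullet> b) \<partial>std_gaussian) =
    (\<integral>\<^sup>+x. (\<Prod>c\<in>Basis. ?f c (x \<bullet> c)) \<partial>(lborel :: (real^'n) measure))"
    unfolding std_gaussian_def std_gaussian_density_prod
    by (subst nn_integral_density)
      (auto intro!: nn_integral_cong simp: prod.distrib prod_ennreal prod.delta b)
  also have "\<dots> = (\<Prod>c\<in>(Basis :: (real^'n) set). \<integral>\<^sup>+t. ?f c t \<partial>lborel)"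
    by (rule nn_integral_lborel_prod) auto
  also have "\<dots> = (\<Prod>c\<in>(Basis :: (real^'n) set). if c = b then \<integral>\<^sup>+t. ?f b t \<partial>lborel else 1)"
    by (intro prod.cong) (auto simp: one)
  finally show ?thesis by (simp add: prod.delta b)
qed

lemma distr_std_gaussian_inner:
  fixes b :: "real ^ 'n"
  assumes "b \<in> Basis"
  shows "distr std_gaussian borel (\<lambda>x. x \<bullet> b) = density lborel std_normal_density"
proof (rule measure_eqI)
  fix A assume "A \<in> sets (distr std_gaussian borel (\<lambda>x. x \<bullet> b))"
  then have [measurable]: "A \<in> sets borel" by simp
  have "emeasure (distr std_gaussian borel (\<lambda>x. x \<bullet> b)) A = (\<integral>\<^sup>+x. indicator A (x \<bullet> b) \<partial>std_gaussian)"
    by (subst nn_integral_indicator[symmetric], simp, subst nn_integral_distr) auto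
  then show "emeasure (distr std_gaussian borel (\<lambda>x. x \<bullet> b)) A = emeasure (density lborel std_normal_density) A"
    by (simp add: nn_integral_std_gaussian_inner assms emeasure_density)
qed simp

text \<open>A pushforward keeps the total mass, so it is enough to look at one coordinate, whose law
  is the normal distribution.\<close>

lemma prob_space_std_gaussian: "prob_space (std_gaussian :: (real ^ 'n) measure)"
proof -
  obtain b :: "real ^ 'n" where b: "b \<in> Basis" using nonempty_Basis by blast
  show ?thesis
    by (rule prob_space_distrD[where N = borel and f = "\<lambda>x. x \<bullet> b"])
      (auto simp: distr_std_gaussian_inner[OF b] prob_space_normal_density)
qed

interpretation std_gaussian: prob_space "std_gaussian :: (real ^ 'n) measure"
  by (rule prob_space_std_gaussian)

text \<open>Used to read integrals against a marginal as integrals against the coupling.\<close>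

lemma has_bochner_integral_distrD:
  fixes h :: "'b \<Rightarrow> 'c :: {banach, second_countable_topology}"
  assumes T: "T \<in> M \<rightarrow>\<^sub>M N" and h: "has_bochner_integral (distr M N T) h I"
  shows "has_bochner_integral M (\<lambda>x. h (T x)) I"
proof -
  have "h \<in> borel_measurable N"
    using borel_measurable_has_bochner_integral[OF h] by simp
  from integrable_distr_eq[OF T this] integral_distr[OF T this] show ?thesis
    using h by (simp add: has_bochner_integral_iff)
qed

lemma std_gaussian_const:
  fixes c :: "'b :: {banach, second_countable_topology}"
  shows "has_bochner_integral (std_gaussian :: (real ^ 'n) measure) (\<lambda>x. c) c"
  by (simp add: has_bochner_integral_iff std_gaussian.prob_space[simplified])

lemma has_bochner_integral_std_gaussian_inner:
  fixes b :: "real ^ 'n"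
  assumes "b \<in> Basis" "h \<in> borel_measurable borel"
    and "has_bochner_integral lborel (\<lambda>t. std_normal_density t * h t) (I :: real)"
  shows "has_bochner_integral std_gaussian (\<lambda>x. h (x \<bullet> b)) I"
proof -
  have "has_bochner_integral (distr std_gaussian borel (\<lambda>x. x \<bullet> b)) h I"
    unfolding distr_std_gaussian_inner[OF assms(1)]
    using assms by (intro has_bochner_integral_density) auto
  then show ?thesis
    by (rule has_bochner_integral_distrD[rotated]) simp
qed

lemma
  fixes b :: "real ^ 'n"
  assumes b: "b \<in> Basis"
  shows std_gaussian_moment_1: "has_bochner_integral std_gaussian (\<lambda>x. x \<bullet> b) 0"
    and std_gaussian_moment_2: "has_bochner_integral std_gaussian (\<lambda>x. (x \<bullet> b)\<^sup>2) 1"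
    and std_gaussian_moment_4: "has_bochner_integral std_gaussian (\<lambda>x. (x \<bullet> b)^4) 3"
  using has_bochner_integral_std_gaussian_inner[OF b _ std_normal_moment_odd[of 0]]
    has_bochner_integral_std_gaussian_inner[OF b _ std_normal_moment_even[of 1]]
    has_bochner_integral_std_gaussian_inner[OF b _ std_normal_moment_even[of 2]]
  by (simp_all add: fact_numeral)

lemma std_gaussian_inner:
  fixes a :: "real ^ 'n"
  shows "has_bochner_integral std_gaussian (\<lambda>x. x \<bullet> a) 0"
proof -
  have "has_bochner_integral std_gaussian (\<lambda>x. \<Sum>b\<in>Basis. (x \<bullet> b) * (a \<bullet> b)) (\<Sum>b\<in>(Basis :: (real^'n) set). 0 * (a \<bullet> b))"
    by (intro has_bochner_integral_sum has_bochner_integral_mult_left std_gaussian_moment_1)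
  then show ?thesis by (simp add: euclidean_inner[symmetric])
qed

lemma std_gaussian_norm_power2:
  "has_bochner_integral std_gaussian (\<lambda>x :: real ^ 'n. (norm x)\<^sup>2) (real CARD('n))"
proof -
  have "has_bochner_integral std_gaussian (\<lambda>x :: real ^ 'n. \<Sum>b\<in>Basis. (x \<bullet> b)\<^sup>2) (\<Sum>b\<in>(Basis :: (real^'n) set). 1)"
    by (intro has_bochner_integral_sum std_gaussian_moment_2)
  also have "(\<lambda>x. \<Sum>b\<in>Basis. (x \<bullet> b)\<^sup>2) = (\<lambda>x :: real ^ 'n. (norm x)\<^sup>2)"
    by (simp add: norm_power2_eq_sum_Basis)
  finally show ?thesis by simp
qed

lemma std_gaussian_ident: "has_bochner_integral std_gaussian (\<lambda>x :: real ^ 'n. x) 0"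
proof -
  have int: "integrable std_gaussian (\<lambda>x :: real ^ 'n. x)"
  proof (rule Bochner_Integration.integrable_bound)
    show "integrable std_gaussian (\<lambda>x :: real ^ 'n. 1 + (norm x)\<^sup>2)"
      using has_bochner_integral_iff std_gaussian_norm_power2 by (intro Bochner_Integration.integrable_add) auto
    have "norm x \<le> 1 + (norm x)\<^sup>2" for x :: "real ^ 'n"
      using sum_squares_bound[of 1 "norm x"] norm_ge_zero[of x] unfolding power_one by linarith
    then show "AE x :: real ^ 'n in std_gaussian. norm x \<le> norm (1 + (norm x)\<^sup>2)"
      by simp
  qed simp
  \<comment> \<open>The vector-valued integral is tested against all vectors; taking
    \<open>b\<close> to be the integral itself shows that it vanishes.\<close>
  have "(\<integral>x. x \<partial>std_gaussian) \<bullet> b = 0" for b :: "real ^ 'n"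
    using std_gaussian_inner[of b] int by (simp add: has_bochner_integral_iff)
  then have "integral\<^sup>L std_gaussian (\<lambda>x :: real ^ 'n. x) = 0"
    by (metis inner_eq_zero_iff)
  then show ?thesis using int by (simp add: has_bochner_integral_iff)
qed

section \<open>Translates of the Gaussian and their Cameron-Martin densities\<close>

definition shift_density :: "real ^ 'n \<Rightarrow> real ^ 'n \<Rightarrow> real" where
  "shift_density a x = exp (x \<bullet> a - (norm a)\<^sup>2 / 2)"

lemma borel_measurable_shift_density [measurable]: "shift_density a \<in> borel_measurable borel"
  unfolding shift_density_def by measurable

lemma shift_density_pos: "0 < shift_density a x"
  by (simp add: shift_density_def)

lemma ln_shift_density: "ln (shift_density a x) = x \<bullet> a - (norm a)\<^sup>2 / 2"
  by (simp add: shift_density_def)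

text \<open>Lebesgue measure is translation invariant, and expanding the square in the exponent of
  the density at \<open>x - a\<close> leaves the factor \<open>shift_density a x\<close>.\<close>

lemma distr_std_gaussian_shift:
  fixes a :: "real ^ 'n"
  shows "distr std_gaussian borel (\<lambda>x. x + a) = density std_gaussian (shift_density a)"
proof -
  let ?C = "(2 * pi) powr (- (real CARD('n) / 2))"
  let ?d = "\<lambda>x :: real ^ 'n. ?C * exp (- (norm x)\<^sup>2 / 2)"
  have eq: "?d (x - a) = ?d x * shift_density a x" for x
    by (simp add: shift_density_def power2_norm_eq_inner exp_add[symmetric] algebra_simps inner_commute
        diff_divide_distrib add_divide_distrib)
  have "distr std_gaussian borel (\<lambda>x. x + a) = density (distr lborel borel (\<lambda>x. x + a)) (\<lambda>x. ennreal (?d (x - a)))"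
    unfolding std_gaussian_def by (subst density_distr) auto
  also have "distr lborel borel (\<lambda>x. x + a) = lborel"
  proof -
    have "(\<lambda>x. x + a) = (+) a" by (auto simp: add.commute)
    then show ?thesis by (simp add: lborel_distr_plus)
  qed
  also have "density lborel (\<lambda>x. ennreal (?d (x - a))) = density std_gaussian (shift_density a)"
    unfolding std_gaussian_def eq
    by (subst density_density_eq) (auto simp: ennreal_mult shift_density_pos less_imp_le)
  finally show ?thesis .
qed

lemma nn_integral_shift_density:
  fixes a :: "real ^ 'n"
  assumes [measurable]: "h \<in> borel_measurable borel"
  shows "(\<integral>\<^sup>+x. ennreal (shift_density a x) * h x \<partial>std_gaussian) = (\<integral>\<^sup>+x. h (x + a) \<partial>std_gaussian)"
  by (subst nn_integral_density[symmetric], simp, simp)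
    (simp add: distr_std_gaussian_shift[symmetric] nn_integral_distr)

lemma has_bochner_integral_shift_density:
  fixes a :: "real ^ 'n" and h :: "real ^ 'n \<Rightarrow> 'b :: {banach, second_countable_topology}"
  assumes [measurable]: "h \<in> borel_measurable borel"
    and h: "has_bochner_integral std_gaussian (\<lambda>x. h (x + a)) I"
  shows "has_bochner_integral std_gaussian (\<lambda>x. shift_density a x *\<^sub>R h x) I"
proof -
  have "has_bochner_integral (density std_gaussian (shift_density a)) h I"
    unfolding distr_std_gaussian_shift[symmetric]
    by (rule has_bochner_integral_distr) (use h in auto)
  then show ?thesis
    by (simp add: has_bochner_integral_iff integrable_density integral_density shift_density_pos less_imp_le)
qed

section \<open>Finite mixtures of translated Gaussians\<close>

text \<open>The estimates are proved for any finite set of shifts. The shifts are distinct, so they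
  can serve as the indices of the weights.\<close>

locale gaussian_mixture =
  fixes E :: "(real ^ 'n) set" and w :: "real ^ 'n \<Rightarrow> real"
  assumes finite_shifts: "finite E"
    and weight_pos: "\<And>e. e \<in> E \<Longrightarrow> 0 < w e"
    and sum_weights: "(\<Sum>e\<in>E. w e) = 1"
begin

definition mix_density :: "real ^ 'n \<Rightarrow> real" where
  "mix_density x = (\<Sum>e\<in>E. w e * shift_density e x)"

definition mixture :: "(real ^ 'n) measure" where
  "mixture = density std_gaussian (\<lambda>x. ennreal (mix_density x))"

text \<open>For \<open>X\<close> drawn from the mixture, this is the conditional probability given \<open>X = x\<close>
  that \<open>X\<close> comes from a component with shift in \<open>D\<close>.\<close>

definition posterior :: "(real ^ 'n) set \<Rightarrow> real ^ 'n \<Rightarrow> real" where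
  "posterior D x = (\<Sum>e\<in>D. w e * shift_density e x) / mix_density x"

lemma borel_measurable_mix_density [measurable]: "mix_density \<in> borel_measurable borel"
  unfolding mix_density_def by measurable

lemma borel_measurable_posterior [measurable]: "posterior D \<in> borel_measurable borel"
  unfolding posterior_def by measurable

lemma shifts_nonempty: "E \<noteq> {}"
  using sum_weights by auto

lemma mix_density_pos: "0 < mix_density x"
  unfolding mix_density_def
  by (intro sum_pos finite_shifts shifts_nonempty mult_pos_pos weight_pos shift_density_pos)

lemma posterior_nonneg: "D \<subseteq> E \<Longrightarrow> 0 \<le> posterior D x"
  unfolding posterior_def
  by (intro divide_nonneg_pos sum_nonneg mix_density_pos mult_nonneg_nonneg)
    (auto simp: shift_density_pos weight_pos less_imp_le)

lemma posterior_le_1: "D \<subseteq> E \<Longrightarrow> posterior D x \<le> 1"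
  unfolding posterior_def divide_le_eq_1_pos[OF mix_density_pos]
  unfolding mix_density_def
  by (rule sum_mono2) (auto simp: finite_shifts shift_density_pos weight_pos less_imp_le)

lemma posterior_all: "posterior E x = 1"
  using mix_density_pos[of x] by (simp add: posterior_def mix_density_def)

lemma
  shows sets_mixture [simp, measurable_cong]: "sets mixture = sets borel"
    and space_mixture [simp]: "space mixture = UNIV"
  by (simp_all add: mixture_def)

lemma nn_integral_mixture:
  assumes [measurable]: "h \<in> borel_measurable borel"
  shows "(\<integral>\<^sup>+x. h x \<partial>mixture) = (\<Sum>e\<in>E. ennreal (w e) * (\<integral>\<^sup>+x. h (x + e) \<partial>std_gaussian))"
proof -
  have "(\<integral>\<^sup>+x. h x \<partial>mixture) = (\<integral>\<^sup>+x. (\<Sum>e\<in>E. ennreal (w e) * (ennreal (shift_density e x) * h x)) \<partial>std_gaussian)"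
    unfolding mixture_def mix_density_def
    by (subst nn_integral_density)
      (auto intro!: nn_integral_cong sum.cong
        simp: sum_ennreal[symmetric] ennreal_mult sum_distrib_right weight_pos shift_density_pos less_imp_le mult.assoc)
  also have "\<dots> = (\<Sum>e\<in>E. ennreal (w e) * (\<integral>\<^sup>+x. ennreal (shift_density e x) * h x \<partial>std_gaussian))"
    by (subst nn_integral_sum) (auto simp: nn_integral_cmult)
  finally show ?thesis
    by (simp add: nn_integral_shift_density)
qed

lemma prob_space_mixture: "prob_space mixture"
proof (rule prob_spaceI)
  have "emeasure mixture (space mixture) = (\<integral>\<^sup>+x. 1 \<partial>mixture)"
    by simp
  also have "\<dots> = (\<Sum>e\<in>E. ennreal (w e))"
    unfolding nn_integral_mixture[OF borel_measurable_const] by (simp add: std_gaussian.emeasure_space_1[simplified])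
  also have "\<dots> = 1"
    by (simp add: sum_ennreal weight_pos less_imp_le sum_weights)
  finally show "emeasure mixture (space mixture) = 1" .
qed

text \<open>The denominator of \<open>posterior D\<close> cancels the density of the mixture, so
  only the components with shift in \<open>D\<close> remain.\<close>

lemma has_bochner_integral_posterior:
  fixes h :: "real ^ 'n \<Rightarrow> 'b :: {banach, second_countable_topology}"
  assumes [measurable]: "h \<in> borel_measurable borel"
    and h: "\<And>e. e \<in> D \<Longrightarrow> has_bochner_integral std_gaussian (\<lambda>x. h (x + e)) (I e)"
  shows "has_bochner_integral mixture (\<lambda>x. posterior D x *\<^sub>R h x) (\<Sum>e\<in>D. w e *\<^sub>R I e)"
proof -
  have "has_bochner_integral std_gaussian (\<lambda>x. \<Sum>e\<in>D. w e *\<^sub>R (shift_density e x *\<^sub>R h x)) (\<Sum>e\<in>D. w e *\<^sub>R I e)"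
    by (intro has_bochner_integral_sum has_bochner_integral_scaleR_right has_bochner_integral_shift_density h) auto
  also have "(\<lambda>x. \<Sum>e\<in>D. w e *\<^sub>R (shift_density e x *\<^sub>R h x)) = (\<lambda>x. mix_density x *\<^sub>R (posterior D x *\<^sub>R h x))"
    using mix_density_pos by (auto simp: posterior_def scaleR_sum_left less_le)
  finally show ?thesis
    unfolding mixture_def
    by (intro has_bochner_integral_density) (auto simp: mix_density_pos less_imp_le)
qed

lemma has_bochner_integral_mixture:
  fixes h :: "real ^ 'n \<Rightarrow> 'b :: {banach, second_countable_topology}"
  assumes "h \<in> borel_measurable borel"
    and "\<And>e. e \<in> E \<Longrightarrow> has_bochner_integral std_gaussian (\<lambda>x. h (x + e)) (I e)"
  shows "has_bochner_integral mixture h (\<Sum>e\<in>E. w e *\<^sub>R I e)"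
  using has_bochner_integral_posterior[of h E I] assms by (simp add: posterior_all)

lemma integrable_mix_density: "integrable std_gaussian mix_density"
  unfolding mix_density_def
proof (intro Bochner_Integration.integrable_sum integrable_mult_right)
  fix e
  show "integrable std_gaussian (shift_density e)"
    using has_bochner_integral_shift_density[where h = "\<lambda>x. 1 :: real" and a = e, OF _ std_gaussian_const]
    by (simp add: has_bochner_integral_iff)
qed

text \<open>In the expansion of the square of \<open>norm (x + e)\<close> the cross term has mean 0,
  so each shift adds its own squared length to the dimension.\<close>

lemma second_moment_mixture:
  "second_moment mixture = ennreal (real CARD('n) + (\<Sum>e\<in>E. w e * (norm e)\<^sup>2))"
proof -
  have "has_bochner_integral std_gaussian (\<lambda>x. (norm (x + e))\<^sup>2) (real CARD('n) + (norm e)\<^sup>2)" for e :: "real ^ 'n"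
  proof -
    have "has_bochner_integral std_gaussian (\<lambda>x. (norm x)\<^sup>2 + (2 * (x \<bullet> e) + (norm e)\<^sup>2)) (real CARD('n) + (2 * 0 + (norm e)\<^sup>2))"
      by (intro has_bochner_integral_add has_bochner_integral_mult_right std_gaussian_norm_power2
          std_gaussian_inner std_gaussian_const)
    then show ?thesis
      by (simp add: power2_norm_eq_inner algebra_simps inner_commute)
  qed
  then have "has_bochner_integral mixture (\<lambda>x. (norm x)\<^sup>2) (\<Sum>e\<in>E. w e *\<^sub>R (real CARD('n) + (norm e)\<^sup>2))"
    by (intro has_bochner_integral_mixture) auto
  also have "(\<Sum>e\<in>E. w e *\<^sub>R (real CARD('n) + (norm e)\<^sup>2)) = real CARD('n) + (\<Sum>e\<in>E. w e * (norm e)\<^sup>2)"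
    by (simp add: distrib_left sum.distrib sum_distrib_right[symmetric] sum_weights)
  finally show ?thesis
    unfolding second_moment_def by (subst nn_integral_eq_integral) (auto simp: has_bochner_integral_iff)
qed

lemma mean_mixture: "has_bochner_integral mixture (\<lambda>x. x) (\<Sum>e\<in>E. w e *\<^sub>R e)"
proof (intro has_bochner_integral_mixture)
  fix e :: "real ^ 'n"
  have "has_bochner_integral std_gaussian (\<lambda>x. x + e) (0 + e)"
    by (intro has_bochner_integral_add std_gaussian_ident std_gaussian_const)
  then show "has_bochner_integral std_gaussian (\<lambda>x. x + e) e" by simp
qed simp

end

section \<open>Entropy and transport cost of mixtures\<close>

lemma sqrt_ennreal_mono: "x \<le> y \<Longrightarrow> sqrt_ennreal x \<le> sqrt_ennreal y"
  by (cases x; cases y) (auto simp: sqrt_ennreal_def top_unique intro!: ennreal_leI)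

text \<open>For negative \<open>x\<close> both sides are 0, so lower bounds on the transport cost
  can be stated without a condition on their sign.\<close>

lemma sqrt_ennreal_ennreal: "sqrt_ennreal (ennreal x) = ennreal (sqrt x)"
  by (cases "0 \<le> x") (auto simp: sqrt_ennreal_def ennreal_neg)

text \<open>The function may change sign: \<open>ennreal\<close> cuts off its negative part, which
  can only increase the integral.\<close>

lemma ennreal_integral_le_nn_integral:
  fixes f :: "'a \<Rightarrow> real"
  assumes "integrable M f"
  shows "ennreal (integral\<^sup>L M f) \<le> (\<integral>\<^sup>+x. ennreal (f x) \<partial>M)"
proof -
  have "ennreal (integral\<^sup>L M f) \<le> ennreal (\<integral>x. max 0 (f x) \<partial>M)"
    by (intro ennreal_leI integral_mono integrable_max assms) auto
  also have "\<dots> = (\<integral>\<^sup>+x. ennreal (max 0 (f x)) \<partial>M)"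
    by (intro nn_integral_eq_integral[symmetric] integrable_max assms) auto
  also have "(\<lambda>x. ennreal (max 0 (f x))) = (\<lambda>x. ennreal (f x))"
    by (auto simp: max_def ennreal_neg)
  finally show ?thesis .
qed

text \<open>Here \<open>q\<close> is the probability, given \<open>x\<close>, that \<open>x\<close> belongs to the distant mass; \<open>\<eta>\<close> and \<open>\<theta>\<close> are
  the parameters of two applications of AM-GM, to \<open>x y\<close> and to \<open>q y\<^sup>2\<close>. All terms on the left depend
  on \<open>x\<close> only or on \<open>y\<close> only, so their integrals are the same for all couplings.\<close>

lemma weighted_square_le:
  fixes q x y \<eta> \<theta> :: real
  assumes "0 \<le> q" "q \<le> 1" "0 < \<eta>" "0 < \<theta>"
  shows "(1 - \<eta>) * (q * x\<^sup>2) - (\<theta> * y ^ 4 + q / \<theta>) / (2 * \<eta>) \<le> (x - y)\<^sup>2"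
proof -
  have "0 \<le> (\<eta> * x - y)\<^sup>2" by simp
  then have "2 * \<eta> * (x * y) \<le> \<eta>\<^sup>2 * x\<^sup>2 + y\<^sup>2"
    by (simp add: power2_eq_square algebra_simps)
  then have "2 * (x * y) \<le> \<eta> * x\<^sup>2 + y\<^sup>2 / \<eta>"
    using \<open>0 < \<eta>\<close> by (simp add: field_simps power2_eq_square)
  then have "(1 - \<eta>) * x\<^sup>2 - y\<^sup>2 / \<eta> \<le> (x - y)\<^sup>2"
    by (simp add: power2_eq_square algebra_simps) (smt (verit) zero_le_square)
  then have "q * ((1 - \<eta>) * x\<^sup>2 - y\<^sup>2 / \<eta>) \<le> q * (x - y)\<^sup>2"
    using assms by (intro mult_left_mono) auto
  also have "\<dots> \<le> (x - y)\<^sup>2"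
    using assms by (intro mult_left_le_one_le) auto
  finally have 1: "(1 - \<eta>) * (q * x\<^sup>2) - (q * y\<^sup>2) / \<eta> \<le> (x - y)\<^sup>2"
    by (simp add: algebra_simps)
  have "0 \<le> (\<theta> * y\<^sup>2 - q)\<^sup>2" by simp
  then have "2 * \<theta> * (q * y\<^sup>2) \<le> \<theta>\<^sup>2 * y ^ 4 + q\<^sup>2"
    by (simp add: power2_eq_square power4_eq_xxxx algebra_simps)
  \<comment> \<open>This makes the bound linear in \<open>q\<close>, which matters because the
    integral of the posterior is known exactly.\<close>
  also have "q\<^sup>2 \<le> q"
    using assms by (simp add: power2_eq_square mult_left_le_one_le)
  finally have "2 * (q * y\<^sup>2) \<le> \<theta> * y ^ 4 + q / \<theta>"
    using \<open>0 < \<theta>\<close> by (simp add: field_simps power2_eq_square)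
  then have "(q * y\<^sup>2) / \<eta> \<le> (\<theta> * y ^ 4 + q / \<theta>) / (2 * \<eta>)"
    using \<open>0 < \<eta>\<close> by (simp add: field_simps)
  with 1 show ?thesis by linarith
qed

section \<open>Entropy of a mixture\<close>

context gaussian_mixture
begin

text \<open>Jensen's inequality for t ln t, obtained from ln u \<le> u - 1 with u the ratio of the
  mixture density to a component; the error terms cancel in the weighted sum.\<close>

lemma mix_entropy_upper:
  "mix_density x * ln (mix_density x) \<le> (\<Sum>e\<in>E. w e * (shift_density e x * ln (shift_density e x)))"
proof -
  let ?f = "mix_density x" and ?g = "\<lambda>e. shift_density e x"
  have "w e * (?g e * ln ?f) \<le> w e * (?g e * ln (?g e) + ?f - ?g e)" if "e \<in> E" for e
  proof (intro mult_left_mono)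
    have "ln (?f / ?g e) \<le> ?f / ?g e - 1"
      by (intro ln_le_minus_one divide_pos_pos mix_density_pos shift_density_pos)
    then have "?g e * (ln ?f - ln (?g e)) \<le> ?g e * (?f / ?g e - 1)"
      using shift_density_pos[of e x] mix_density_pos[of x]
      by (intro mult_left_mono) (auto simp: ln_div)
    then show "?g e * ln ?f \<le> ?g e * ln (?g e) + ?f - ?g e"
      using shift_density_pos[of e x] by (simp add: algebra_simps)
  qed (use weight_pos that in \<open>auto intro: less_imp_le\<close>)
  then have "(\<Sum>e\<in>E. w e * (?g e * ln ?f)) \<le> (\<Sum>e\<in>E. w e * (?g e * ln (?g e) + ?f - ?g e))"
    by (rule sum_mono)
  also have "(\<Sum>e\<in>E. w e * (?g e * ln ?f)) = ?f * ln ?f"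
    by (simp add: mix_density_def sum_distrib_right mult.assoc)
  also have "(\<Sum>e\<in>E. w e * (?g e * ln (?g e) + ?f - ?g e)) =
    (\<Sum>e\<in>E. w e * (?g e * ln (?g e))) + (\<Sum>e\<in>E. w e) * ?f - ?f"
    by (simp add: algebra_simps sum.distrib sum_subtractf sum_distrib_right[symmetric] mix_density_def)
  finally show ?thesis by (simp add: sum_weights)
qed

text \<open>Each weighted component is at most the whole density, and \<open>ln\<close> is monotone.
  After integration the gap to the upper bound is only the entropy of the weights.\<close>

lemma mix_entropy_lower:
  "(\<Sum>e\<in>E. w e * (shift_density e x * (ln (w e) + ln (shift_density e x))))
    \<le> mix_density x * ln (mix_density x)"
proof -
  have "(\<Sum>e\<in>E. w e * (shift_density e x * (ln (w e) + ln (shift_density e x))))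
    \<le> (\<Sum>e\<in>E. w e * (shift_density e x * ln (mix_density x)))"
  proof (intro sum_mono mult_left_mono)
    fix e assume e: "e \<in> E"
    have pos: "0 < w e * shift_density e x"
      using e by (intro mult_pos_pos weight_pos shift_density_pos)
    have "w e * shift_density e x \<le> mix_density x"
      unfolding mix_density_def using e finite_shifts
      by (intro member_le_sum) (auto simp: weight_pos shift_density_pos less_imp_le)
    then have "ln (w e * shift_density e x) \<le> ln (mix_density x)"
      using pos by (simp add: mix_density_pos)
    then show "ln (w e) + ln (shift_density e x) \<le> ln (mix_density x)"
      using weight_pos[OF e] shift_density_pos[of e x] by (simp add: ln_mult)
  qed (auto simp: weight_pos shift_density_pos less_imp_le)
  also have "\<dots> = mix_density x * ln (mix_density x)"
    by (simp add: mix_density_def sum_distrib_right mult.assoc)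
  finally show ?thesis .
qed

text \<open>The translate by \<open>e\<close> has relative entropy
  \<open>(norm e)\<^sup>2 / 2\<close>. The constants \<open>c\<close> allow one computation for both
  bounds: \<open>ln (w e)\<close> for the lower one, 0 for the upper one.\<close>

lemma has_bochner_integral_sum_shift_entropy:
  "has_bochner_integral std_gaussian
    (\<lambda>x. \<Sum>e\<in>E. w e * (shift_density e x * (c e + ln (shift_density e x))))
    (\<Sum>e\<in>E. w e * (c e + (norm e)\<^sup>2 / 2))"
proof (intro has_bochner_integral_sum has_bochner_integral_mult_right)
  fix e :: "real ^ 'n"
  have "has_bochner_integral std_gaussian (\<lambda>x. x \<bullet> e + (c e + (norm e)\<^sup>2 / 2)) (0 + (c e + (norm e)\<^sup>2 / 2))"
    by (intro has_bochner_integral_add std_gaussian_inner std_gaussian_const)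
  then have "has_bochner_integral std_gaussian
    (\<lambda>x. c e + ((x + e) \<bullet> e - (norm e)\<^sup>2 / 2)) (c e + (norm e)\<^sup>2 / 2)"
    by (simp add: inner_add_left power2_norm_eq_inner algebra_simps)
  then show "has_bochner_integral std_gaussian (\<lambda>x. shift_density e x * (c e + ln (shift_density e x)))
    (c e + (norm e)\<^sup>2 / 2)"
    using has_bochner_integral_shift_density[of "\<lambda>x. c e + (x \<bullet> e - (norm e)\<^sup>2 / 2)" e]
    unfolding ln_shift_density by simp
qed

lemma integrable_mix_entropy: "integrable std_gaussian (\<lambda>x. mix_density x * ln (mix_density x))"
proof (rule Bochner_Integration.integrable_bound)
  let ?L = "\<lambda>x. \<Sum>e\<in>E. w e * (shift_density e x * (ln (w e) + ln (shift_density e x)))"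
  let ?U = "\<lambda>x. \<Sum>e\<in>E. w e * (shift_density e x * ln (shift_density e x))"
  show "integrable std_gaussian (\<lambda>x. \<bar>?L x\<bar> + \<bar>?U x\<bar>)"
    using has_bochner_integral_sum_shift_entropy[of "\<lambda>e. ln (w e)"]
      has_bochner_integral_sum_shift_entropy[of "\<lambda>e. 0"]
    by (intro Bochner_Integration.integrable_add integrable_abs) (auto simp: has_bochner_integral_iff)
  show "AE x in std_gaussian. norm (mix_density x * ln (mix_density x)) \<le> norm (\<bar>?L x\<bar> + \<bar>?U x\<bar>)"
  proof (rule AE_I2)
    fix x
    show "norm (mix_density x * ln (mix_density x)) \<le> norm (\<bar>?L x\<bar> + \<bar>?U x\<bar>)"
      using mix_entropy_lower[of x] mix_entropy_upper[of x] unfolding real_norm_def by linarith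
  qed
qed simp

text \<open>\<open>RN_deriv\<close> agrees with \<open>mix_density\<close> almost everywhere, and
  integrability makes both parts finite, so the extended difference is an ordinary one.\<close>

lemma rel_entropy_mixture:
  "rel_entropy mixture = ereal (\<integral>x. mix_density x * ln (mix_density x) \<partial>std_gaussian)"
proof -
  let ?h = "\<lambda>x. mix_density x * ln (mix_density x)"
  let ?f = "\<lambda>x. enn2real (RN_deriv std_gaussian mixture x)"
  have ac: "absolutely_continuous std_gaussian mixture"
    unfolding mixture_def by (rule absolutely_continuousI_density) simp
  have "AE x in std_gaussian. ennreal (mix_density x) = RN_deriv std_gaussian mixture x"
    by (rule std_gaussian.RN_deriv_unique) (auto simp: mixture_def)
  then have AE: "AE x in std_gaussian. ?f x = mix_density x"
  proof eventually_elim
    case (elim x)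
    from elim[symmetric] show ?case by (simp add: mix_density_pos less_imp_le)
  qed
  have "(\<integral>\<^sup>+ x. ennreal (?f x * ln (?f x)) \<partial>std_gaussian) = (\<integral>\<^sup>+ x. ennreal (?h x) \<partial>std_gaussian)"
    by (rule nn_integral_cong_AE) (use AE in eventually_elim, simp)
  moreover have "(\<integral>\<^sup>+ x. ennreal (- (?f x * ln (?f x))) \<partial>std_gaussian) = (\<integral>\<^sup>+ x. ennreal (- ?h x) \<partial>std_gaussian)"
    by (rule nn_integral_cong_AE) (use AE in eventually_elim, simp)
  moreover obtain r s where "0 \<le> r" "(\<integral>\<^sup>+ x. ennreal (?h x) \<partial>std_gaussian) = ennreal r"
    "0 \<le> s" "(\<integral>\<^sup>+ x. ennreal (- ?h x) \<partial>std_gaussian) = ennreal s" "integral\<^sup>L std_gaussian ?h = r - s"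
    using integrable_mix_entropy by (rule integrableE)
  ultimately show ?thesis
    using ac by (simp add: rel_entropy_def)
qed

lemma rel_entropy_mixture_bounds:
  obtains H where "rel_entropy mixture = ereal H"
    "(\<Sum>e\<in>E. w e * (ln (w e) + (norm e)\<^sup>2 / 2)) \<le> H" "H \<le> (\<Sum>e\<in>E. w e * ((norm e)\<^sup>2 / 2))"
proof
  let ?H = "\<integral>x. mix_density x * ln (mix_density x) \<partial>std_gaussian"
  note hbi = has_bochner_integral_sum_shift_entropy[of "\<lambda>e. ln (w e)"]
      has_bochner_integral_sum_shift_entropy[of "\<lambda>e. 0", simplified]
  show "rel_entropy mixture = ereal ?H" by (rule rel_entropy_mixture)
  show "(\<Sum>e\<in>E. w e * (ln (w e) + (norm e)\<^sup>2 / 2)) \<le> ?H"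
    using hbi(1) integral_mono[OF _ integrable_mix_entropy mix_entropy_lower]
    by (simp add: has_bochner_integral_iff)
  show "?H \<le> (\<Sum>e\<in>E. w e * ((norm e)\<^sup>2 / 2))"
    using hbi(2) integral_mono[OF integrable_mix_entropy _ mix_entropy_upper]
    by (simp add: has_bochner_integral_iff)
qed

section \<open>Transport cost between a mixture and the Gaussian\<close>

text \<open>Draw a shift \<open>e\<close> with probability \<open>w e\<close> and, independently, a standard Gaussian \<open>x\<close>;
  the coupling is the law of \<open>(x + e, x)\<close>.\<close>

lemma W2_mixture_le: "W2 mixture std_gaussian \<le> ennreal (sqrt (\<Sum>e\<in>E. w e * (norm e)\<^sup>2))"
proof -
  let ?P = "point_measure E (\<lambda>e. ennreal (w e)) \<Otimes>\<^sub>M (std_gaussian :: (real ^ 'n) measure)"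
  let ?T = "\<lambda>z :: (real ^ 'n) \<times> (real ^ 'n). (snd z + fst z, snd z)"
  let ?\<pi> = "distr ?P (borel \<Otimes>\<^sub>M borel) ?T"
  \<comment> \<open>The sigma-algebra of \<open>point_measure\<close> is discrete, so every map from
    it into \<open>borel\<close> is measurable.\<close>
  have fst_P: "fst \<in> borel_measurable ?P"
    by (rule measurable_compose[OF measurable_fst]) (simp add: point_measure_def)
  have T [measurable]: "?T \<in> ?P \<rightarrow>\<^sub>M borel \<Otimes>\<^sub>M borel"
    using fst_P by measurable
  \<comment> \<open>Both marginals and the cost follow from this formula, with indicators or the
    squared distance for \<open>h\<close>.\<close>
  have nn: "(\<integral>\<^sup>+z. h z \<partial>?\<pi>) = (\<Sum>e\<in>E. ennreal (w e) * (\<integral>\<^sup>+x. h (x + e, x) \<partial>std_gaussian))"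
    if [measurable]: "h \<in> borel_measurable (borel \<Otimes>\<^sub>M borel)" for h
  proof -
    have "(\<integral>\<^sup>+z. h z \<partial>?\<pi>) = (\<integral>\<^sup>+z. h (?T z) \<partial>?P)"
      by (rule nn_integral_distr) auto
    also have "\<dots> = (\<integral>\<^sup>+e. \<integral>\<^sup>+x. h (?T (e, x)) \<partial>std_gaussian \<partial>point_measure E (\<lambda>e. ennreal (w e)))"
      by (rule std_gaussian.nn_integral_fst[symmetric]) measurable
    finally show ?thesis by (simp add: nn_integral_point_measure_finite finite_shifts)
  qed
  have emeasure_eq: "emeasure (distr ?\<pi> borel p) A = (\<integral>\<^sup>+z. indicator A (p z) \<partial>?\<pi>)"
    if [measurable]: "p \<in> borel \<Otimes>\<^sub>M borel \<rightarrow>\<^sub>M borel" "A \<in> sets borel" for p and A :: "(real ^ 'n) set"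
    by (subst nn_integral_indicator[symmetric], simp, subst nn_integral_distr) auto
  have fst_eq: "distr ?\<pi> borel fst = mixture"
  proof (rule measure_eqI)
    fix A assume "A \<in> sets (distr ?\<pi> borel fst)"
    then have [measurable]: "A \<in> sets borel" by simp
    have "emeasure (distr ?\<pi> borel fst) A = (\<integral>\<^sup>+x. indicator A x \<partial>mixture)"
      by (simp add: emeasure_eq nn nn_integral_mixture del: nn_integral_indicator)
    then show "emeasure (distr ?\<pi> borel fst) A = emeasure mixture A" by simp
  qed simp
  have snd_eq: "distr ?\<pi> borel snd = std_gaussian"
  proof (rule measure_eqI)
    fix A assume "A \<in> sets (distr ?\<pi> borel snd)"
    then have [measurable]: "A \<in> sets borel" by simp
    have "emeasure (distr ?\<pi> borel snd) A = (\<Sum>e\<in>E. ennreal (w e)) * emeasure std_gaussian A"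
      by (simp add: emeasure_eq nn sum_distrib_right)
    then show "emeasure (distr ?\<pi> borel snd) A = emeasure std_gaussian A"
      by (simp add: sum_ennreal weight_pos less_imp_le sum_weights)
  qed simp
  have "prob_space ?\<pi>"
    by (rule prob_space_distrD[where N = borel and f = snd])
      (unfold snd_eq, auto simp: prob_space_std_gaussian)
  then have "?\<pi> \<in> couplings mixture std_gaussian"
    by (simp add: couplings_def fst_eq snd_eq)
  then have "W2 mixture std_gaussian \<le> sqrt_ennreal (\<integral>\<^sup>+ z. ennreal ((norm (fst z - snd z))\<^sup>2) \<partial>?\<pi>)"
    unfolding W2_def by (rule INF_lower)
  also have "(\<integral>\<^sup>+ z. ennreal ((norm (fst z - snd z))\<^sup>2) \<partial>?\<pi>) = (\<Sum>e\<in>E. ennreal (w e) * ennreal ((norm e)\<^sup>2))"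
    by (subst nn) (auto simp: std_gaussian.emeasure_space_1[simplified])
  also have "\<dots> = ennreal (\<Sum>e\<in>E. w e * (norm e)\<^sup>2)"
    by (simp add: sum_ennreal[symmetric] ennreal_mult weight_pos less_imp_le)
  finally show ?thesis by (simp add: sqrt_ennreal_ennreal)
qed

text \<open>\<open>weighted_square_le\<close> is integrated with \<open>posterior D\<close> for
  \<open>q\<close> and the coordinates along \<open>b\<close> for the two points; the 3 is the
  fourth moment of a normal variable. Using one coordinate discards no part of a shift that is a
  multiple of \<open>b\<close>.\<close>

lemma W2_mixture_ge:
  assumes D: "D \<subseteq> E" and b: "b \<in> Basis" and \<eta>: "0 < \<eta>" "\<eta> \<le> 1" and \<theta>: "0 < \<theta>"
  shows "ennreal (sqrt ((1 - \<eta>) * (\<Sum>e\<in>D. w e * (e \<bullet> b)\<^sup>2) - (3 * \<theta> + (\<Sum>e\<in>D. w e) / \<theta>) / (2 * \<eta>)))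
    \<le> W2 mixture std_gaussian"
  unfolding W2_def
proof (rule INF_greatest)
  let ?p = "\<Sum>e\<in>D. w e" and ?s = "\<Sum>e\<in>D. w e * (e \<bullet> b)\<^sup>2"
  fix \<pi> assume \<pi>: "\<pi> \<in> couplings mixture std_gaussian"
  then have [measurable_cong]: "sets \<pi> = sets (borel \<Otimes>\<^sub>M borel)"
    and fst_eq: "distr \<pi> borel fst = mixture" and snd_eq: "distr \<pi> borel snd = std_gaussian"
    by (auto simp: couplings_def)
  have fst_int: "has_bochner_integral \<pi> (\<lambda>z. h (fst z)) I"
    if "has_bochner_integral mixture h I" for h :: "real ^ 'n \<Rightarrow> real" and I
    using that unfolding fst_eq[symmetric] by (rule has_bochner_integral_distrD[rotated]) simp
  have snd_int: "has_bochner_integral \<pi> (\<lambda>z. h (snd z)) I"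
    if "has_bochner_integral std_gaussian h I" for h :: "real ^ 'n \<Rightarrow> real" and I
    using that unfolding snd_eq[symmetric] by (rule has_bochner_integral_distrD[rotated]) simp
  have shifted: "has_bochner_integral std_gaussian (\<lambda>x. ((x + e) \<bullet> b)\<^sup>2) (1 + (e \<bullet> b)\<^sup>2)" for e
  proof -
    have "has_bochner_integral std_gaussian (\<lambda>x. (x \<bullet> b)\<^sup>2 + (2 * (e \<bullet> b) * (x \<bullet> b) + (e \<bullet> b)\<^sup>2))
      (1 + (2 * (e \<bullet> b) * 0 + (e \<bullet> b)\<^sup>2))"
      by (intro has_bochner_integral_add has_bochner_integral_mult_right std_gaussian_moment_1
          std_gaussian_moment_2 std_gaussian_const b)
    then show ?thesis
      by (simp add: inner_add_left power2_eq_square algebra_simps)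
  qed
  from has_bochner_integral_posterior[where h = "\<lambda>x. (x \<bullet> b)\<^sup>2" and D = D, OF _ shifted]
  have "has_bochner_integral mixture (\<lambda>x. posterior D x * (x \<bullet> b)\<^sup>2) (?p + ?s)"
    by (simp add: distrib_left sum.distrib)
  note X2 = fst_int[OF this]
  from has_bochner_integral_posterior[where h = "\<lambda>x. 1 :: real" and D = D, OF _ std_gaussian_const]
  have "has_bochner_integral mixture (posterior D) ?p" by simp
  note Q = fst_int[OF this]
  note Y4 = snd_int[OF std_gaussian_moment_4[OF b]]
  let ?G = "\<lambda>z. (1 - \<eta>) * (posterior D (fst z) * (fst z \<bullet> b)\<^sup>2)
    - (\<theta> * (snd z \<bullet> b) ^ 4 + posterior D (fst z) / \<theta>) / (2 * \<eta>)"
  have G: "has_bochner_integral \<pi> ?G ((1 - \<eta>) * (?p + ?s) - (\<theta> * 3 + ?p / \<theta>) / (2 * \<eta>))"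
    by (intro has_bochner_integral_diff has_bochner_integral_add has_bochner_integral_mult_right
        has_bochner_integral_divide_zero X2 Q Y4)
  \<comment> \<open>The Gaussian variance contributes \<open>(1 - \<eta>) * ?p\<close> to the
    integral; it is nonnegative as \<eta> \<le> 1 and is dropped.\<close>
  have "0 \<le> ?p"
    using D by (intro sum_nonneg less_imp_le weight_pos) auto
  then have "(1 - \<eta>) * ?s - (3 * \<theta> + ?p / \<theta>) / (2 * \<eta>) \<le> integral\<^sup>L \<pi> ?G"
    using G \<eta> by (simp add: has_bochner_integral_iff distrib_left mult.commute)
  then have "ennreal ((1 - \<eta>) * ?s - (3 * \<theta> + ?p / \<theta>) / (2 * \<eta>)) \<le> ennreal (integral\<^sup>L \<pi> ?G)"
    by (rule ennreal_leI)
  also have "\<dots> \<le> (\<integral>\<^sup>+z. ennreal (?G z) \<partial>\<pi>)"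
    using G by (intro ennreal_integral_le_nn_integral) (simp add: has_bochner_integral_iff)
  also have "\<dots> \<le> (\<integral>\<^sup>+z. ennreal ((norm (fst z - snd z))\<^sup>2) \<partial>\<pi>)"
  proof (intro nn_integral_mono ennreal_leI)
    fix z
    have "?G z \<le> (fst z \<bullet> b - snd z \<bullet> b)\<^sup>2"
      by (intro weighted_square_le posterior_nonneg posterior_le_1 D \<eta> \<theta>)
    also have "\<dots> \<le> (norm (fst z - snd z))\<^sup>2"
      using power_mono[OF Basis_le_norm[OF b, of "fst z - snd z"], of 2] by (simp add: inner_diff_left)
    finally show "?G z \<le> (norm (fst z - snd z))\<^sup>2" .
  qed
  finally show "ennreal (sqrt ((1 - \<eta>) * ?s - (3 * \<theta> + ?p / \<theta>) / (2 * \<eta>)))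
    \<le> sqrt_ennreal (\<integral>\<^sup>+z. ennreal ((norm (fst z - snd z))\<^sup>2) \<partial>\<pi>)"
    unfolding sqrt_ennreal_ennreal[symmetric] by (rule sqrt_ennreal_mono)
qed

end

text \<open>A single parameter \<open>q\<close> governs the distant mass, the distance and both
  AM-GM parameters, so that every error term tends to 0 with \<open>q\<close>.\<close>

lemma three_point_mixture:
  fixes s q :: real
  assumes s: "0 < s" and q: "0 < q" "q < 1"
  obtains f :: "real ^ 'n \<Rightarrow> real" and \<mu> :: "(real ^ 'n) measure" and H W :: real
  where "\<And>x. 0 \<le> f x" "integrable std_gaussian f" "\<mu> = density std_gaussian (\<lambda>x. ennreal (f x))"
    "\<mu> \<in> P2 (real CARD('n) + s)" "centered \<mu>"
    "rel_entropy \<mu> = ereal H"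
    "(1 - q ^ 4) * ln (1 - q ^ 4) + q ^ 4 * ln (q ^ 4 / 2) + s / 2 \<le> H" "H \<le> s / 2"
    "W2 \<mu> std_gaussian = ennreal W" "0 \<le> W" "sqrt ((1 - q) * s - 2 * q) \<le> W" "W \<le> sqrt s"
proof -
  obtain b :: "real ^ 'n" where b: "b \<in> Basis" using nonempty_Basis by blast
  \<comment> \<open>The distant mass is the fourth power of \<open>q\<close>, and \<open>R\<close>
    is chosen so that \<open>p * R\<^sup>2 = s\<close>.\<close>
  define p where "p = q ^ 4"
  define R where "R = sqrt s / q\<^sup>2"
  define a where "a = R *\<^sub>R b"
  define w where "w e = (if e = 0 then 1 - p else p / 2)" for e :: "real ^ 'n"
  have p: "0 < p" "p < 1"
    using q power_strict_mono[of q 1 4] by (auto simp: p_def)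
  have R: "0 < R" and pR: "p * R\<^sup>2 = s"
    using s q by (auto simp: R_def p_def power_divide power_mult[symmetric])
  have a: "a \<noteq> 0" "a \<noteq> - a" "norm a = R" "a \<bullet> b = R"
    using R b nonzero_Basis[OF b] by (auto simp: a_def eq_neg_iff_add_eq_0 scaleR_add_left[symmetric])
  \<comment> \<open>The three shifts must be distinct for the sum over the set to split into three
    terms.\<close>
  have sum_E: "(\<Sum>e\<in>{0, a, - a}. h e) = h 0 + (h a + h (- a))" for h :: "real ^ 'n \<Rightarrow> 'c :: comm_monoid_add"
    using a by simp
  have sum_D: "(\<Sum>e\<in>{a, - a}. h e) = h a + h (- a)" for h :: "real ^ 'n \<Rightarrow> real"
    using a by simp
  interpret gaussian_mixture "{0, a, - a}" w
    by standard (use p a in \<open>auto simp: w_def sum_E\<close>)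
  have w: "w 0 = 1 - p" "w a = p / 2" "w (- a) = p / 2"
    using a by (auto simp: w_def)
  obtain H where H: "rel_entropy mixture = ereal H"
    "(\<Sum>e\<in>{0, a, - a}. w e * (ln (w e) + (norm e)\<^sup>2 / 2)) \<le> H"
    "H \<le> (\<Sum>e\<in>{0, a, - a}. w e * ((norm e)\<^sup>2 / 2))"
    by (rule rel_entropy_mixture_bounds)
  have H_lower: "(1 - q ^ 4) * ln (1 - q ^ 4) + q ^ 4 * ln (q ^ 4 / 2) + s / 2 \<le> H"
    using H(2) pR unfolding sum_E p_def[symmetric] by (simp add: w a algebra_simps)
  have H_upper: "H \<le> s / 2"
    using H(3) pR unfolding sum_E by (simp add: w a)
  have W_upper: "W2 mixture std_gaussian \<le> ennreal (sqrt s)"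
    using W2_mixture_le pR unfolding sum_E by (simp add: w a)
  then obtain W where W: "W2 mixture std_gaussian = ennreal W" "0 \<le> W" "W \<le> sqrt s"
    using s by (auto simp: le_ennreal_iff)
  \<comment> \<open>With \<eta> = \<open>q\<close> and \<theta> = \<open>q\<^sup>2\<close>, the
    terms \<open>3 * \<theta>\<close> and \<open>p / \<theta>\<close> are both of order
    \<open>q\<^sup>2\<close>, and division by \<open>2 * \<eta>\<close> leaves an error of order
    \<open>q\<close>.\<close>
  have "(3 * q\<^sup>2 + p / q\<^sup>2) / (2 * q) = 2 * q"
    using q by (simp add: p_def field_simps power2_eq_square power4_eq_xxxx)
  then have "ennreal (sqrt ((1 - q) * s - 2 * q)) \<le> W2 mixture std_gaussian"
    using W2_mixture_ge[of "{a, - a}" b q "q\<^sup>2"] b q pR unfolding sum_D by (simp add: w a)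
  then have W_lower: "sqrt ((1 - q) * s - 2 * q) \<le> W"
    using W by simp
  have "second_moment mixture = ennreal (real CARD('n) + s)"
    using pR unfolding second_moment_mixture sum_E by (simp add: w a)
  then have P2: "mixture \<in> P2 (real CARD('n) + s)"
    by (simp add: P2_def prob_space_mixture)
  \<comment> \<open>The opposite shifts carry equal weights and cancel.\<close>
  have "has_bochner_integral mixture (\<lambda>x. x) 0"
    using mean_mixture unfolding sum_E by (simp add: w)
  then have "centered mixture"
    by (simp add: centered_def has_bochner_integral_iff)
  from that[OF less_imp_le[OF mix_density_pos] integrable_mix_density mixture_def P2 this
      H(1) H_lower H_upper W(1,2) W_lower W(3)]
  show ?thesis .
qed

section \<open>Passage to the limit\<close>

theorem theorem1p7:
  fixes M :: real
  assumes "M > real CARD('n::finite)"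
  shows "\<exists>(f :: nat \<Rightarrow> real ^ 'n \<Rightarrow> real) (\<mu> :: nat \<Rightarrow> (real ^ 'n) measure) (c :: real).
    (\<forall>k. (\<forall>x. 0 \<le> f k x) \<and> integrable std_gaussian (f k) \<and>
         \<mu> k = density std_gaussian (\<lambda>x. ennreal (f k x)) \<and>
         \<mu> k \<in> P2 M \<and> centered (\<mu> k)) \<and>
    ((\<lambda>k. talagrand_deficit (\<mu> k)) \<longlonglongrightarrow> 0) \<and>
    0 < c \<and>
    ((\<lambda>k. W2 (\<mu> k) std_gaussian) \<longlonglongrightarrow> ennreal c)"
proof -
  define s where "s = M - real CARD('n)"
  \<comment> \<open>The offset 2 keeps \<open>q k\<close> strictly below 1 already at
    \<open>k = 0\<close>.\<close>
  define q where "q k = 1 / (real k + 2)" for k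
  have s: "0 < s" and M: "M = real CARD('n) + s"
    using assms by (auto simp: s_def)
  have q: "0 < q k" "q k < 1" for k
    by (auto simp: q_def)
  have "\<forall>k. \<exists>(f :: real ^ 'n \<Rightarrow> real) \<mu> H W. (\<forall>x. 0 \<le> f x) \<and> integrable std_gaussian f \<and>
    \<mu> = density std_gaussian (\<lambda>x. ennreal (f x)) \<and> \<mu> \<in> P2 M \<and> centered \<mu> \<and>
    rel_entropy \<mu> = ereal H \<and>
    (1 - q k ^ 4) * ln (1 - q k ^ 4) + q k ^ 4 * ln (q k ^ 4 / 2) + s / 2 \<le> H \<and> H \<le> s / 2 \<and>
    W2 \<mu> std_gaussian = ennreal W \<and> 0 \<le> W \<and> sqrt ((1 - q k) * s - 2 * q k) \<le> W \<and> W \<le> sqrt s"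
    (is "\<forall>k. \<exists>f \<mu> H W. ?P k f \<mu> H W")
  proof
    fix k
    show "\<exists>f \<mu> H W. ?P k f \<mu> H W"
      unfolding M by (rule three_point_mixture[OF s q[of k], where 'n = 'n]) blast
  qed
  then have "\<exists>f \<mu> H W. \<forall>k. ?P k (f k) (\<mu> k) (H k) (W k)"
    unfolding choice_iff .
  then obtain f \<mu> H W where P: "\<And>k. ?P k (f k) (\<mu> k) (H k) (W k)"
    by (elim exE) (rule that, erule spec)
  have W2_eq: "W2 (\<mu> k) std_gaussian = ennreal (W k)" for k
    using P[of k] by blast
  have H_lim: "H \<longlonglongrightarrow> s / 2"
  proof (rule tendsto_sandwich)
    \<comment> \<open>The entropy of the weights vanishes in the limit, since t ln t tends to 0 both
      as t tends to 0 and as t tends to 1.\<close>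
    have "(\<lambda>k. (1 - q k ^ 4) * ln (1 - q k ^ 4) + q k ^ 4 * ln (q k ^ 4 / 2)) \<longlonglongrightarrow> 0"
      unfolding q_def by real_asymp
    from tendsto_add[OF this tendsto_const[of "s / 2"]]
    show "(\<lambda>k. (1 - q k ^ 4) * ln (1 - q k ^ 4) + q k ^ 4 * ln (q k ^ 4 / 2) + s / 2) \<longlonglongrightarrow> s / 2"
      by simp
  qed (use P in auto)
  have W_lim: "W \<longlonglongrightarrow> sqrt s"
  proof (rule tendsto_sandwich)
    have "q \<longlonglongrightarrow> 0"
      unfolding q_def by real_asymp
    then have "(\<lambda>k. sqrt ((1 - q k) * s - 2 * q k)) \<longlonglongrightarrow> sqrt ((1 - 0) * s - 2 * 0)"
      by (intro tendsto_intros)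
    then show "(\<lambda>k. sqrt ((1 - q k) * s - 2 * q k)) \<longlonglongrightarrow> sqrt s"
      by simp
  qed (use P in auto)
  have "(\<lambda>k. 2 * H k - (W k)\<^sup>2) \<longlonglongrightarrow> 2 * (s / 2) - (sqrt s)\<^sup>2"
    by (intro tendsto_intros H_lim W_lim)
  then have "(\<lambda>k. ereal (2 * H k - (W k)\<^sup>2)) \<longlonglongrightarrow> 0"
    using s by (simp add: zero_ereal_def)
  \<comment> \<open>Entropy and transport cost are both finite, so the extended subtraction is that
    of real numbers.\<close>
  moreover have "talagrand_deficit (\<mu> k) = ereal (2 * H k - (W k)\<^sup>2)" for k
  proof -
    have "rel_entropy (\<mu> k) = ereal (H k)" "0 \<le> W k"
      using P[of k] by blast+
    then show ?thesis
      unfolding talagrand_deficit_def W2_eq by (simp add: ennreal_power)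
  qed
  ultimately have deficit_lim: "(\<lambda>k. talagrand_deficit (\<mu> k)) \<longlonglongrightarrow> 0"
    by (simp only:)
  have W2_lim: "(\<lambda>k. W2 (\<mu> k) std_gaussian) \<longlonglongrightarrow> ennreal (sqrt s)"
    unfolding W2_eq by (rule tendsto_ennrealI[OF W_lim])
  have "0 < sqrt s" using s by simp
  then show ?thesis
    by (intro exI[of _ f] exI[of _ \<mu>] exI[of _ "sqrt s"]) (use P deficit_lim W2_lim in blast)
qed

end
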